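(* Let $(\mathcal{A},\phi)$ be a non-commutative probability space supported by a real Hilbert space $H$, let $\{X_i\}_{1\le i\le d}$ be elements of $\mathcal{A}$ that are symmetric operators, and let $\{a_{x_i}^-\}_{1\le i\le d}$, $\{a_{x_i}^0\}_{1\le i\le d}$, $\{a_{x_i}^+\}_{1\le i\le d}$ be a joint annihilation-preservation-creation (APC) decomposition of $\{X_i\}_{1\le i\le d}$ relative to $\mathcal{A}$. Let $\mathcal{A}'$ be the unital algebra generated by $\{X_i\}_{1\le i\le d}$, and let $\{a^-(i)\}_{1\le i\le d}$, $\{a^0(i)\}_{1\le i\le d}$, $\{a^+(i)\}_{1\le i\le d}$ be the minimal joint APC decomposition of $\{X_i\}_{1\le i\le d}$. Then for every $i\in\{1,\dots,d\}$ and every $\epsilon\in\{-,0,+\}$, $$a_{x_i}^{\epsilon}|_{\mathcal{A}'\phi}=a^{\epsilon}(i)|_{\mathcal{A}'\phi}.$$ Moreover, if $\mathcal{A}''$ denotes the unital algebra generated by $\bigcup_{i=1}^d\{a_{x_i}^-,a_{x_i}^0,a_{x_i}^+\}$, then $\mathcal{A}''\phi=\mathcal{A}'\phi$, and $\{a_{x_i}^-\}_{1\le i\le d}$, $\{a_{x_i}^0\}_{1\le i\le d}$, $\{a_{x_i}^+\}_{1\le i\le d}$ is a joint APC decomposition of $\{X_i\}_{1\le i\le d}$ relative to $\mathcal{A}''$.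
   Context: **Non-commutative probability space.** $H$ is a real Hilbert space, $\mathcal{A}$ is a unital algebra of densely defined linear operators on $H$, and $\phi\in H$ (the vacuum vector) belongs to the domain of every $g\in\mathcal{A}$; $(\mathcal{A},\phi)$ is then called a (non-commutative) probability space supported by $H$. For an algebra $\mathcal{B}$ of operators, $\mathcal{B}\phi:=\{g\phi\mid g\in\mathcal{B}\}$. **Joint APC decomposition relative to $\mathcal{A}$.** Let $\{a_{x_i}^-\}$, $\{a_{x_i}^0\}$, $\{a_{x_i}^+\}$, $1\le i\le d$, be linear operators defined on subspaces of $H$ such that $\phi$ belongs to the domain of $a_{x_{i_1}}^{\epsilon_1}a_{x_{i_2}}^{\epsilon_2}\cdots a_{x_{i_n}}^{\epsilon_n}$ for all $n\ge1$, $(i_1,\dots,i_n)\in\{1,\dots,d\}^n$, $(\epsilon_1,\dots,\epsilon_n)\in\{-,0,+\}^n$. Put $H_{-1}:=\{0\}$, $H_0:=\mathbb{R}\phi$, and for $k\ge1$ let $H_k$ be the span of all vectors $a_{x_{i_1}}^+a_{x_{i_2}}^+\cdots a_{x_{i_k}}^+\phi$, $i_1,\dots,i_k\in\{1,\dots,d\}$. These families form a joint APC decomposition of $\{X_i\}$ relative to $\mathcal{A}$ if for all $1\le i\le d$, $n\ge0$: - $X_i=a_{x_i}^-+a_{x_i}^0+a_{x_i}^+$ (on $\mathcal{A}\phi$); - $(a_{x_i}^+)^*|_{\mathcal{A}\phi}=a_{x_i}^-|_{\mathcal{A}\phi}$, meaning $\langle a_{x_i}^+u,v\rangle=\langle u,a_{x_i}^-v\rangle$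 for all $u,v\in\mathcal{A}\phi$ (in particular $\mathcal{A}\phi$ lies in the domains of these operators); - $a_{x_i}^-H_n\subset H_{n-1}$; - $a_{x_i}^0H_n\subset H_n$. **Minimal joint APC decomposition.** For $n\ge0$ let $F_n$ be the (finite-dimensional) space of all vectors $p(X_1,\dots,X_d)\phi$, $p$ a real polynomial in $d$ non-commuting variables of degree $\le n$; $G_0:=F_0$, $G_n:=F_n\ominus F_{n-1}$ for $n\ge1$, $G_{-1}:=\{0\}$. Then $\mathcal{A}'\phi=\bigcup_nF_n$ is the algebraic orthogonal direct sum of the $G_n$, and, since the $X_i$ are symmetric, $X_iG_n\subset G_{n-1}\oplus G_n\oplus G_{n+1}$. The minimal joint APC decomposition consists of the unique operators on $\mathcal{A}'\phi$ with $X_i=a^-(i)+a^0(i)+a^+(i)$, $a^-(i):G_n\to G_{n-1}$, $a^0(i):G_n\to G_n$, $a^+(i):G_n\to G_{n+1}$ for all $n\ge0$. *)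

theory Defs
  imports "HOL-Analysis.Analysis"
begin

section \<open>Partially defined linear operators\<close>

text \<open>
  An operator defined on part of \<open>H\<close> is a partial map, its domain being \<open>dom T\<close>. Sum, scalar
  multiple and product carry their natural domains: \<open>S + T\<close> lives on \<open>dom S \<inter> dom T\<close>, and the
  product is the partial composition \<open>S \<circ>\<^sub>m T\<close>, defined at \<open>u\<close> iff \<open>u \<in> dom T\<close> and
  \<open>T u \<in> dom S\<close>.
\<close>

type_synonym 'h partial_op = "'h \<Rightarrow> 'h option"

definition linear_op :: "'h::real_vector partial_op \<Rightarrow> bool" where
  "linear_op T \<longleftrightarrow> subspace (dom T) \<and>
     (\<forall>u v x y. T u = Some x \<longrightarrow> T v = Some y \<longrightarrow> T (u + v) = Some (x + y)) \<and>
     (\<forall>c u x. T u = Some x \<longrightarrow> T (c *\<^sub>R u) = Some (c *\<^sub>R x))"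

definition densely_defined :: "'h::topological_space partial_op \<Rightarrow> bool" where
  "densely_defined T \<longleftrightarrow> closure (dom T) = UNIV"

definition symmetric_op :: "'h::real_inner partial_op \<Rightarrow> bool" where
  "symmetric_op T \<longleftrightarrow> linear_op T \<and> densely_defined T \<and>
     (\<forall>u v x y. T u = Some x \<longrightarrow> T v = Some y \<longrightarrow> inner x v = inner u y)"

definition op_add :: "'h::plus partial_op \<Rightarrow> 'h partial_op \<Rightarrow> 'h partial_op" where
  "op_add S T = (\<lambda>u. case (S u, T u) of (Some x, Some y) \<Rightarrow> Some (x + y) | _ \<Rightarrow> None)"

definition op_scale :: "real \<Rightarrow> 'h::real_vector partial_op \<Rightarrow> 'h partial_op" where
  "op_scale c T = (\<lambda>u. map_option ((*\<^sub>R) c) (T u))"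

definition op_image :: "'h partial_op \<Rightarrow> 'h set \<Rightarrow> 'h set" where
  "op_image T S = {v. \<exists>u\<in>S. T u = Some v}"

text \<open>The operator product \<open>T\<^sub>1 T\<^sub>2 \<cdots> T\<^sub>n\<close>; the identity of \<open>H\<close> is the map \<open>Some\<close>.\<close>

definition op_prod :: "'h partial_op list \<Rightarrow> 'h partial_op" where
  "op_prod Ts = foldr (\<circ>\<^sub>m) Ts Some"


section \<open>Algebras of operators\<close>

text \<open>
  The unit is only required to be the identity on its own domain, so that algebras of operators
  on a common invariant dense domain \<open>D\<close>, with unit the identity of \<open>D\<close>, are covered as well as
  algebras containing the identity of \<open>H\<close>.
\<close>

definition unital_op_algebra :: "'h::real_vector partial_op set \<Rightarrow> bool" where
  "unital_op_algebra A \<longleftrightarrow>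
     (\<forall>g\<in>A. linear_op g) \<and>
     (\<exists>e\<in>A. e \<subseteq>\<^sub>m Some \<and> (\<forall>g\<in>A. e \<circ>\<^sub>m g = g \<and> g \<circ>\<^sub>m e = g)) \<and>
     (\<forall>g\<in>A. \<forall>h\<in>A. op_add g h \<in> A) \<and>
     (\<forall>c. \<forall>g\<in>A. op_scale c g \<in> A) \<and>
     (\<forall>g\<in>A. \<forall>h\<in>A. g \<circ>\<^sub>m h \<in> A)"

definition nc_prob_space ::
    "'h::{real_inner, complete_space} partial_op set \<Rightarrow> 'h \<Rightarrow> bool" where
  "nc_prob_space A \<phi> \<longleftrightarrow>
     unital_op_algebra A \<and> (\<forall>g\<in>A. densely_defined g) \<and> (\<forall>g\<in>A. \<phi> \<in> dom g)"

inductive_set generated_algebra :: "'h::real_vector partial_op set \<Rightarrow> 'h partial_op set"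
  for S :: "'h partial_op set" where
  unit: "Some \<in> generated_algebra S"
| gen: "g \<in> S \<Longrightarrow> g \<in> generated_algebra S"
| add: "g \<in> generated_algebra S \<Longrightarrow> h \<in> generated_algebra S \<Longrightarrow> op_add g h \<in> generated_algebra S"
| scale: "g \<in> generated_algebra S \<Longrightarrow> op_scale c g \<in> generated_algebra S"
| mult: "g \<in> generated_algebra S \<Longrightarrow> h \<in> generated_algebra S \<Longrightarrow> g \<circ>\<^sub>m h \<in> generated_algebra S"

text \<open>The set \<open>B\<phi> = {g\<phi> | g \<in> B}\<close>.\<close>

definition orbit :: "'h partial_op set \<Rightarrow> 'h \<Rightarrow> 'h set" where
  "orbit B \<phi> = {v. \<exists>g\<in>B. g \<phi> = Some v}"


section \<open>Joint APC decompositions\<close>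

datatype apc = Ann | Pres | Cre  \<comment> \<open>the superscripts \<open>-\<close>, \<open>0\<close>, \<open>+\<close>\<close>

definition apc_sum :: "(apc \<Rightarrow> 'h::plus partial_op) \<Rightarrow> 'h partial_op" where
  "apc_sum b = op_add (op_add (b Ann) (b Pres)) (b Cre)"

text \<open>\<open>pred_space S n\<close> is \<open>S\<^bsub>n-1\<^esub>\<close>, with the convention \<open>S\<^bsub>-1\<^esub> = {0}\<close>.\<close>

definition pred_space :: "(nat \<Rightarrow> 'h::zero set) \<Rightarrow> nat \<Rightarrow> 'h set" where
  "pred_space S n = (case n of 0 \<Rightarrow> {0} | Suc m \<Rightarrow> S m)"

text \<open>The spaces \<open>H\<^sub>k\<close>; for \<open>k = 0\<close> the only word is empty and this is the span of \<open>\<phi>\<close>.\<close>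

definition chaos ::
    "nat \<Rightarrow> (apc \<Rightarrow> nat \<Rightarrow> 'h::real_vector partial_op) \<Rightarrow> 'h \<Rightarrow> nat \<Rightarrow> 'h set" where
  "chaos d a \<phi> k =
     span {v. \<exists>w. length w = k \<and> set w \<subseteq> {1..d} \<and> op_prod (map (a Cre) w) \<phi> = Some v}"

definition joint_apc ::
    "nat \<Rightarrow> (nat \<Rightarrow> 'h::real_inner partial_op) \<Rightarrow> (apc \<Rightarrow> nat \<Rightarrow> 'h partial_op) \<Rightarrow> 'h \<Rightarrow>
     'h partial_op set \<Rightarrow> bool" where
  "joint_apc d X a \<phi> B \<longleftrightarrow>
     (\<forall>\<epsilon>. \<forall>i\<in>{1..d}. linear_op (a \<epsilon> i)) \<and>
     (\<forall>w. w \<noteq> [] \<longrightarrow> set w \<subseteq> UNIV \<times> {1..d} \<longrightarrow>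
        \<phi> \<in> dom (op_prod (map (\<lambda>(\<epsilon>, i). a \<epsilon> i) w))) \<and>
     (\<forall>i\<in>{1..d}.
        (\<forall>u\<in>orbit B \<phi>. u \<in> dom (X i) \<and> X i u = apc_sum (\<lambda>\<epsilon>. a \<epsilon> i) u) \<and>
        (\<forall>u\<in>orbit B \<phi>. \<forall>v\<in>orbit B \<phi>.
           \<exists>x y. a Cre i u = Some x \<and> a Ann i v = Some y \<and> inner x v = inner u y) \<and>
        (\<forall>n. op_image (a Ann i) (chaos d a \<phi> n) \<subseteq> pred_space (chaos d a \<phi>) n) \<and>
        (\<forall>n. op_image (a Pres i) (chaos d a \<phi> n) \<subseteq> chaos d a \<phi> n))"


section \<open>The minimal joint APC decomposition\<close>

text \<open>
  A polynomial of degree at most \<open>n\<close> in \<open>d\<close> non-commuting variables is a real coefficient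
  function \<open>c\<close> on the finite set of words of length at most \<open>n\<close> over \<open>{1..d}\<close>. The spaces are
  only used where \<open>\<phi>\<close> lies in the domain of every word in the \<open>X\<^sub>i\<close>, so \<open>the\<close> is harmless.
\<close>

definition poly_space ::
    "nat \<Rightarrow> (nat \<Rightarrow> 'h::real_vector partial_op) \<Rightarrow> 'h \<Rightarrow> nat \<Rightarrow> 'h set" where
  "poly_space d X \<phi> n =
     {\<Sum>w | set w \<subseteq> {1..d} \<and> length w \<le> n. c w *\<^sub>R the (op_prod (map X w) \<phi>) | c :: nat list \<Rightarrow> real. True}"

fun graded_space ::
    "nat \<Rightarrow> (nat \<Rightarrow> 'h::real_inner partial_op) \<Rightarrow> 'h \<Rightarrow> nat \<Rightarrow> 'h set" where
  "graded_space d X \<phi> 0 = poly_space d X \<phi> 0"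
| "graded_space d X \<phi> (Suc n) =
     {v \<in> poly_space d X \<phi> (Suc n). \<forall>u\<in>poly_space d X \<phi> n. orthogonal u v}"

definition is_minimal_apc ::
    "nat \<Rightarrow> (nat \<Rightarrow> 'h::real_inner partial_op) \<Rightarrow> 'h \<Rightarrow> nat \<Rightarrow> (apc \<Rightarrow> 'h partial_op) \<Rightarrow> bool" where
  "is_minimal_apc d X \<phi> i b \<longleftrightarrow>
     (\<forall>\<epsilon>. linear_op (b \<epsilon>) \<and> dom (b \<epsilon>) = orbit (generated_algebra (X ` {1..d})) \<phi>) \<and>
     (\<forall>u\<in>orbit (generated_algebra (X ` {1..d})) \<phi>. X i u = apc_sum b u) \<and>
     (\<forall>n. op_image (b Ann) (graded_space d X \<phi> n) \<subseteq> pred_space (graded_space d X \<phi>) n) \<and>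
     (\<forall>n. op_image (b Pres) (graded_space d X \<phi> n) \<subseteq> graded_space d X \<phi> n) \<and>
     (\<forall>n. op_image (b Cre) (graded_space d X \<phi> n) \<subseteq> graded_space d X \<phi> (Suc n))"

definition minimal_apc ::
    "nat \<Rightarrow> (nat \<Rightarrow> 'h::real_inner partial_op) \<Rightarrow> 'h \<Rightarrow> apc \<Rightarrow> nat \<Rightarrow> 'h partial_op" where
  "minimal_apc d X \<phi> \<epsilon> i = (THE b. is_minimal_apc d X \<phi> i b) \<epsilon>"

end

theory Submission
  imports Defs
begin

text \<open>
  Adjointness of \<open>a\<^sup>+\<close> and \<open>a\<^sup>-\<close> together with \<open>a\<^sup>- H\<^sub>n \<subseteq> H\<^bsub>n-1\<^esub>\<close> makes the spaces \<open>H\<^sub>n\<close> pairwise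
  orthogonal. Since \<open>X\<^sub>i = a\<^sup>- + a\<^sup>0 + a\<^sup>+\<close>, each \<open>H\<^sub>n\<close> consists of polynomial vectors of degree at
  most \<open>n\<close>, and conversely \<open>X\<^sub>i H\<^sub>n \<subseteq> H\<^bsub>n-1\<^esub> + H\<^sub>n + H\<^bsub>n+1\<^esub>\<close> gives \<open>F\<^sub>n = H\<^sub>0 + \<dots> + H\<^sub>n\<close>.
  Hence \<open>G\<^sub>n = H\<^sub>n\<close>, so the given operators restricted to \<open>A'\<phi> = \<Sum>\<^sub>n H\<^sub>n\<close> are graded exactly like
  the minimal ones, and orthogonality makes the splitting of \<open>X\<^sub>i\<close> unique.
\<close>

section \<open>Partial operators and invariant subspaces\<close>

text \<open>Unlike an inclusion of \<open>op_image\<close>, which ignores points where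
  \<open>T\<close> is undefined, this also asserts that \<open>S\<close> lies in the domain, so such
  facts compose.\<close>

definition maps_into :: "'h partial_op \<Rightarrow> 'h set \<Rightarrow> 'h set \<Rightarrow> bool" where
  "maps_into T S W \<longleftrightarrow> (\<forall>u\<in>S. \<exists>v\<in>W. T u = Some v)"

lemma maps_intoI: "(\<And>u. u \<in> S \<Longrightarrow> \<exists>v\<in>W. T u = Some v) \<Longrightarrow> maps_into T S W"
  by (simp add: maps_into_def)

lemma maps_intoE:
  assumes "maps_into T S W" "u \<in> S"
  obtains v where "v \<in> W" "T u = Some v"
  using assms by (auto simp: maps_into_def)

lemma maps_intoD: "maps_into T S W \<Longrightarrow> u \<in> S \<Longrightarrow> T u = Some v \<Longrightarrow> v \<in> W"
  by (auto simp: maps_into_def)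

lemma maps_into_if_op_image:
  assumes "S \<subseteq> dom T" "op_image T S \<subseteq> W"
  shows "maps_into T S W"
proof (rule maps_intoI)
  fix u assume u: "u \<in> S"
  then obtain v where v: "T u = Some v" using assms(1) by blast
  then have "v \<in> W" using u assms(2) by (auto simp: op_image_def)
  then show "\<exists>v\<in>W. T u = Some v" using v by blast
qed

lemma linear_op_subspace_dom: "linear_op T \<Longrightarrow> subspace (dom T)"
  by (simp add: linear_op_def)

lemma linear_op_add:
  "linear_op T \<Longrightarrow> T u = Some x \<Longrightarrow> T v = Some y \<Longrightarrow> T (u + v) = Some (x + y)"
  by (simp add: linear_op_def)

lemma linear_op_scale: "linear_op T \<Longrightarrow> T u = Some x \<Longrightarrow> T (c *\<^sub>R u) = Some (c *\<^sub>R x)"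
  by (simp add: linear_op_def)

lemma linear_op_zero: "linear_op T \<Longrightarrow> T 0 = Some 0"
  using linear_op_scale[of T 0 _ 0] subspace_0[OF linear_op_subspace_dom, of T] by fastforce

lemma linear_op_restrict:
  assumes "linear_op T" "subspace S" "S \<subseteq> dom T"
  shows "linear_op (T |` S)"
proof -
  have "dom (T |` S) = S" using assms(3) by auto
  then show ?thesis
    using assms subspace_add[OF assms(2)] subspace_scale[OF assms(2)]
    unfolding linear_op_def by (auto simp: restrict_map_def split: if_splits)
qed

lemma maps_into_span:
  assumes "linear_op T" "subspace W" "maps_into T S W"
  shows "maps_into T (span S) W"
proof (rule maps_intoI)
  fix u assume "u \<in> span S"
  then show "\<exists>v\<in>W. T u = Some v"
  proof (induction rule: span_induct_alt)
    case base
    then show ?case using assms linear_op_zero subspace_0 by blast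
  next
    case (step c x y)
    then obtain x' y' where "x' \<in> W" "T x = Some x'" "y' \<in> W" "T y = Some y'"
      using assms(3) by (auto elim: maps_intoE)
    then have "T (c *\<^sub>R x + y) = Some (c *\<^sub>R x' + y')" "c *\<^sub>R x' + y' \<in> W"
      using assms by (auto intro: linear_op_add linear_op_scale subspace_add subspace_scale)
    then show ?case by blast
  qed
qed

text \<open>A common value is required on \<open>B\<close>: if both operators were merely undefined
  there, nothing would follow for linear combinations.\<close>

lemma linear_op_eq_on_span:
  assumes "linear_op S" "linear_op T"
    and eq: "\<And>u. u \<in> B \<Longrightarrow> \<exists>v. S u = Some v \<and> T u = Some v"
    and "u \<in> span B"
  shows "S u = T u"
proof -
  from assms(4) have "\<exists>v. S u = Some v \<and> T u = Some v"
  proof (induction rule: span_induct_alt)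
    case base
    then show ?case using assms linear_op_zero by blast
  next
    case (step c x y)
    then obtain x' y' where "S x = Some x'" "T x = Some x'" "S y = Some y'" "T y = Some y'"
      using eq by blast
    then have "S (c *\<^sub>R x + y) = Some (c *\<^sub>R x' + y')" "T (c *\<^sub>R x + y) = Some (c *\<^sub>R x' + y')"
      using assms(1,2) by (auto intro: linear_op_add linear_op_scale)
    then show ?case by blast
  qed
  then show ?thesis by auto
qed

lemma op_prod_Nil [simp]: "op_prod [] = Some"
  by (simp add: op_prod_def)

lemma op_prod_Cons [simp]: "op_prod (T # Ts) = T \<circ>\<^sub>m op_prod Ts"
  by (simp add: op_prod_def)

lemma apc_sum_eq_Some:
  "apc_sum b u = Some z \<longleftrightarrow>
    (\<exists>x y w. b Ann u = Some x \<and> b Pres u = Some y \<and> b Cre u = Some w \<and> z = x + y + w)"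
  by (auto simp: apc_sum_def op_add_def split: option.splits)

section \<open>Generated algebras and orbits of the vacuum\<close>

lemma maps_into_generated_algebra:
  assumes "g \<in> generated_algebra S" "subspace W" "\<And>h. h \<in> S \<Longrightarrow> maps_into h W W"
  shows "maps_into g W W"
  using assms(1)
proof induction
  case unit
  then show ?case by (simp add: maps_into_def)
next
  case (gen g)
  then show ?case using assms(3) by blast
next
  case (add g h)
  then show ?case
    using subspace_add[OF assms(2)] by (fastforce simp: maps_into_def op_add_def)
next
  case (scale g c)
  then show ?case
    using subspace_scale[OF assms(2)] by (fastforce simp: maps_into_def op_scale_def)
next
  case (mult g h)
  then show ?case by (fastforce simp: maps_into_def map_comp_def)
qed

text \<open>Sums and products carry natural domains, which may shrink. An invariant subspace
  containing the vacuum both bounds the orbit and keeps the vacuum in every domain.\<close>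

lemma orbit_generated_subset:
  assumes "subspace W" "\<phi> \<in> W" "\<And>h. h \<in> S \<Longrightarrow> maps_into h W W"
  shows "orbit (generated_algebra S) \<phi> \<subseteq> W" and "\<forall>g\<in>generated_algebra S. \<phi> \<in> dom g"
  using maps_into_generated_algebra[OF _ assms(1,3)] assms(2)
  by (fastforce simp: orbit_def maps_into_def)+

lemma mem_orbit_generated: "\<phi> \<in> orbit (generated_algebra S) \<phi>"
  by (auto simp: orbit_def intro: generated_algebra.unit)

text \<open>The vacuum lies in the domain of \<open>h \<circ>\<^sub>m g\<close>, which forces the
  vector \<open>g \<phi>\<close> into the domain of \<open>h\<close>.\<close>

lemma maps_into_orbit:
  assumes "\<forall>g\<in>B. \<phi> \<in> dom g" "h \<in> B" "\<And>g. g \<in> B \<Longrightarrow> h \<circ>\<^sub>m g \<in> B"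
  shows "maps_into h (orbit B \<phi>) (orbit B \<phi>)"
proof (rule maps_intoI)
  fix u assume "u \<in> orbit B \<phi>"
  then obtain g where g: "g \<in> B" "g \<phi> = Some u" by (auto simp: orbit_def)
  then obtain v where "(h \<circ>\<^sub>m g) \<phi> = Some v" using assms by blast
  then show "\<exists>v\<in>orbit B \<phi>. h u = Some v"
    using g assms(3) by (auto simp: orbit_def map_comp_def intro!: bexI[of _ "h \<circ>\<^sub>m g"])
qed

lemma subspace_orbit:
  assumes "\<forall>g\<in>B. \<phi> \<in> dom g" "B \<noteq> {}"
    and add: "\<And>g h. g \<in> B \<Longrightarrow> h \<in> B \<Longrightarrow> op_add g h \<in> B"
    and scale: "\<And>g c. g \<in> B \<Longrightarrow> op_scale c g \<in> B"
  shows "subspace (orbit B \<phi>)"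
proof (rule subspaceI)
  have sc: "c *\<^sub>R x \<in> orbit B \<phi>" if "x \<in> orbit B \<phi>" for c x
    using that scale by (fastforce simp: orbit_def op_scale_def)
  then show "c *\<^sub>R x \<in> orbit B \<phi>" if "x \<in> orbit B \<phi>" for c x using that by blast
  obtain x where "x \<in> orbit B \<phi>" using assms(1,2) by (force simp: orbit_def)
  from sc[OF this, of 0] show "0 \<in> orbit B \<phi>" by simp
  show "x + y \<in> orbit B \<phi>" if xy: "x \<in> orbit B \<phi>" "y \<in> orbit B \<phi>" for x y
  proof -
    obtain g h where "g \<in> B" "g \<phi> = Some x" "h \<in> B" "h \<phi> = Some y"
      using xy by (auto simp: orbit_def)
    then have "op_add g h \<in> B" "op_add g h \<phi> = Some (x + y)"
      using add by (auto simp: op_add_def)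
    then show ?thesis by (auto simp: orbit_def)
  qed
qed

lemma orbit_generated_invariant:
  assumes "\<forall>g\<in>generated_algebra S. \<phi> \<in> dom g"
  shows "subspace (orbit (generated_algebra S) \<phi>)"
    and "h \<in> S \<Longrightarrow> maps_into h (orbit (generated_algebra S) \<phi>) (orbit (generated_algebra S) \<phi>)"
proof -
  show "subspace (orbit (generated_algebra S) \<phi>)"
    using assms generated_algebra.unit by (intro subspace_orbit) (auto intro: generated_algebra.intros)
  show "maps_into h (orbit (generated_algebra S) \<phi>) (orbit (generated_algebra S) \<phi>)" if "h \<in> S"
    using assms that by (intro maps_into_orbit) (auto intro: generated_algebra.intros)
qed

section \<open>Polynomial vectors\<close>

text \<open>Distinct words may give the same vector, so coefficients indexed by words are exchanged
  for a span, to which linearity arguments apply directly.\<close>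

lemma poly_space_eq_span:
  "poly_space d X \<phi> n =
    span ((\<lambda>w. the (op_prod (map X w) \<phi>)) ` {w. set w \<subseteq> {1..d} \<and> length w \<le> n})"
  (is "?P = span (?f ` ?W)")
proof
  have P: "?P = {\<Sum>w\<in>?W. c w *\<^sub>R ?f w | c. True}"
    by (simp add: poly_space_def)
  have fin: "finite ?W" by (rule finite_lists_length_le) simp
  have "(\<Sum>w\<in>?W. c w *\<^sub>R ?f w) \<in> span (?f ` ?W)" for c
    by (intro span_sum span_scale span_base imageI)
  then show "?P \<subseteq> span (?f ` ?W)" unfolding P by blast
  have "subspace ?P"
    unfolding P
  proof (rule subspaceI)
    show "0 \<in> {\<Sum>w\<in>?W. c w *\<^sub>R ?f w | c. True}"
      by (auto intro!: exI[of _ "\<lambda>_. 0"])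
    fix x y k assume "x \<in> {\<Sum>w\<in>?W. c w *\<^sub>R ?f w | c. True}"
    then obtain c where c: "x = (\<Sum>w\<in>?W. c w *\<^sub>R ?f w)" by blast
    then have "k *\<^sub>R x = (\<Sum>w\<in>?W. (k * c w) *\<^sub>R ?f w)"
      by (simp add: scaleR_sum_right)
    then show "k *\<^sub>R x \<in> {\<Sum>w\<in>?W. c w *\<^sub>R ?f w | c. True}"
      by (auto intro!: exI[of _ "\<lambda>w. k * c w"])
    assume "y \<in> {\<Sum>w\<in>?W. c w *\<^sub>R ?f w | c. True}"
    then obtain e where "y = (\<Sum>w\<in>?W. e w *\<^sub>R ?f w)" by blast
    then have "x + y = (\<Sum>w\<in>?W. (c w + e w) *\<^sub>R ?f w)"
      by (simp add: c scaleR_add_left sum.distrib)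
    then show "x + y \<in> {\<Sum>w\<in>?W. c w *\<^sub>R ?f w | c. True}"
      by (auto intro!: exI[of _ "\<lambda>w. c w + e w"])
  qed
  moreover have "?f ` ?W \<subseteq> ?P"
  proof (rule image_subsetI)
    fix v assume v: "v \<in> ?W"
    \<comment> \<open>A Kronecker delta as coefficient function isolates the word \<open>v\<close>;
      the word set is finite, so the sum is not the default zero.\<close>
    have "(\<Sum>w\<in>?W. (if w = v then 1 else 0) *\<^sub>R ?f w) = (\<Sum>w\<in>?W. if w = v then ?f v else 0)"
      by (rule sum.cong) auto
    also have "\<dots> = ?f v" using fin v by (subst sum.delta) auto
    finally show "?f v \<in> ?P" unfolding P by (auto intro!: exI[of _ "\<lambda>w. if w = v then 1 else 0"])
  qed
  ultimately show "span (?f ` ?W) \<subseteq> ?P" by (rule span_minimal[rotated])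
qed

section \<open>The chaos spaces of a joint APC decomposition\<close>

text \<open>The algebra enters only through universal statements about vectors of its orbit, so they
  survive passage to a smaller orbit.\<close>

lemma joint_apc_antimono:
  assumes "joint_apc d X a \<phi> B" "orbit C \<phi> \<subseteq> orbit B \<phi>"
  shows "joint_apc d X a \<phi> C"
proof -
  note at = assms(1)[unfolded joint_apc_def, THEN conjunct2, THEN conjunct2, THEN bspec]
  have "u \<in> dom (X i) \<and> X i u = apc_sum (\<lambda>\<epsilon>. a \<epsilon> i) u" if "i \<in> {1..d}" "u \<in> orbit C \<phi>" for i u
    using at[OF that(1), THEN conjunct1, THEN bspec] that(2) assms(2) by blast
  moreover have "\<exists>x y. a Cre i u = Some x \<and> a Ann i v = Some y \<and> inner x v = inner u y"
    if "i \<in> {1..d}" "u \<in> orbit C \<phi>" "v \<in> orbit C \<phi>" for i u v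
    by (rule at[OF that(1), THEN conjunct2, THEN conjunct1, THEN bspec, THEN bspec])
      (use that(2,3) assms(2) in auto)
  ultimately show ?thesis
    using assms(1) unfolding joint_apc_def by (intro conjI ballI) simp_all
qed

locale joint_apc_decomposition =
  fixes d :: nat and X :: "nat \<Rightarrow> 'h::{real_inner, complete_space} partial_op"
    and a :: "apc \<Rightarrow> nat \<Rightarrow> 'h partial_op" and \<phi> :: 'h and A :: "'h partial_op set"
  assumes prob: "nc_prob_space A \<phi>"
    and X_mem: "\<And>i. i \<in> {1..d} \<Longrightarrow> X i \<in> A"
    and apc: "joint_apc d X a \<phi> A"
begin

abbreviation "D \<equiv> orbit A \<phi>"
abbreviation "D' \<equiv> orbit (generated_algebra (X ` {1..d})) \<phi>"
abbreviation "D'' \<equiv> orbit (generated_algebra {a \<epsilon> i | \<epsilon> i. i \<in> {1..d}}) \<phi>"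
abbreviation "H \<equiv> chaos d a \<phi>"
abbreviation "F \<equiv> poly_space d X \<phi>"
abbreviation "G \<equiv> graded_space d X \<phi>"

lemma alg: "unital_op_algebra A" and vac_dom: "\<forall>g\<in>A. \<phi> \<in> dom g"
  using prob by (auto simp: nc_prob_space_def)

lemma linear_X: "i \<in> {1..d} \<Longrightarrow> linear_op (X i)"
  using alg X_mem by (auto simp: unital_op_algebra_def)

lemma subspace_D: "subspace D"
  using alg vac_dom by (intro subspace_orbit) (auto simp: unital_op_algebra_def)

lemma vac_mem_D: "\<phi> \<in> D"
proof -
  \<comment> \<open>The unit of \<open>A\<close> may be the identity on a proper domain only; that
    domain contains the vacuum, like every domain in \<open>A\<close>.\<close>
  obtain e where e: "e \<in> A" "e \<subseteq>\<^sub>m Some" using alg by (auto simp: unital_op_algebra_def)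
  then have "e \<phi> = Some \<phi>" using vac_dom by (force simp: map_le_def)
  then show ?thesis using e by (auto simp: orbit_def)
qed

lemma X_maps_D: "i \<in> {1..d} \<Longrightarrow> maps_into (X i) D D"
  using alg vac_dom X_mem by (intro maps_into_orbit) (auto simp: unital_op_algebra_def)

lemma linear_a: "i \<in> {1..d} \<Longrightarrow> linear_op (a \<epsilon> i)"
  using apc by (auto simp: joint_apc_def)

lemma word_dom:
  "w \<noteq> [] \<Longrightarrow> set w \<subseteq> UNIV \<times> {1..d} \<Longrightarrow> \<phi> \<in> dom (op_prod (map (\<lambda>(\<epsilon>, i). a \<epsilon> i) w))"
  using apc by (auto simp: joint_apc_def)

lemma X_split:
  assumes "i \<in> {1..d}" "u \<in> D"
  obtains x y z where "a Ann i u = Some x" "a Pres i u = Some y" "a Cre i u = Some z"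
    "X i u = Some (x + y + z)"
proof -
  have "u \<in> dom (X i)" "X i u = apc_sum (\<lambda>\<epsilon>. a \<epsilon> i) u"
    using apc assms by (auto simp: joint_apc_def)
  then obtain v where v: "X i u = Some v" "apc_sum (\<lambda>\<epsilon>. a \<epsilon> i) u = Some v" by (metis domD)
  then show ?thesis using that by (auto simp: apc_sum_eq_Some)
qed

lemma adjoint:
  assumes "i \<in> {1..d}" "u \<in> D" "v \<in> D" "a Cre i u = Some x" "a Ann i v = Some y"
  shows "inner x v = inner u y"
proof -
  have "\<exists>x y. a Cre i u = Some x \<and> a Ann i v = Some y \<and> inner x v = inner u y"
    using apc assms(1-3) by (auto simp: joint_apc_def)
  then show ?thesis using assms(4,5) by simp
qed

section \<open>The grading by the chaos spaces and its orthogonality\<close>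

lemma subspace_chaos: "subspace (H n)"
  by (simp add: chaos_def)

lemma subspace_pred_chaos: "subspace (pred_space H n)"
  by (cases n) (auto simp: pred_space_def subspace_chaos)

lemma chaos_0: "H 0 = span {\<phi>}"
proof -
  have "{v. \<exists>w. length w = 0 \<and> set w \<subseteq> {1..d} \<and> op_prod (map (a Cre) w) \<phi> = Some v} = {\<phi>}"
    by auto
  then show ?thesis by (simp add: chaos_def)
qed

lemma chaos_Suc:
  "H (Suc n) = span {v. \<exists>i\<in>{1..d}. \<exists>u\<in>H n. a Cre i u = Some v}" (is "_ = span ?S")
proof
  let ?B = "\<lambda>n. {v. \<exists>w. length w = n \<and> set w \<subseteq> {1..d} \<and> op_prod (map (a Cre) w) \<phi> = Some v}"
  have "?B (Suc n) \<subseteq> ?S"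
  proof
    fix v assume "v \<in> ?B (Suc n)"
    then obtain w where w: "length w = Suc n" "set w \<subseteq> {1..d}"
      "op_prod (map (a Cre) w) \<phi> = Some v" by auto
    then obtain i w' where iw: "w = i # w'" by (cases w) auto
    then obtain u where u: "op_prod (map (a Cre) w') \<phi> = Some u" "a Cre i u = Some v"
      using w by (auto simp: map_comp_Some_iff)
    then have "u \<in> H n" unfolding chaos_def using w iw by (auto intro!: span_base)
    then show "v \<in> ?S" using u w iw by auto
  qed
  then show "H (Suc n) \<subseteq> span ?S" unfolding chaos_def by (rule span_mono)
  have "maps_into (a Cre i) (H n) (H (Suc n))" if i: "i \<in> {1..d}" for i
    unfolding chaos_def[of _ _ _ n]
  proof (rule maps_into_span[OF linear_a[OF i] subspace_chaos], rule maps_intoI)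
    fix u assume "u \<in> ?B n"
    then obtain w where w: "length w = n" "set w \<subseteq> {1..d}"
      "op_prod (map (a Cre) w) \<phi> = Some u" by auto
    \<comment> \<open>The domain hypothesis concerns words of mixed type, so a creation word is
      written with every letter tagged \<open>Cre\<close>.\<close>
    have m: "map ((\<lambda>(\<epsilon>, i). a \<epsilon> i) \<circ> Pair Cre) w = map (a Cre) w" by auto
    have "\<phi> \<in> dom (op_prod (map (\<lambda>(\<epsilon>, i). a \<epsilon> i) (map (Pair Cre) (i # w))))"
      using w i by (intro word_dom) auto
    then obtain v where v: "a Cre i u = Some v"
      using w by (auto simp: m map_comp_Some_iff)
    then have "op_prod (map (a Cre) (i # w)) \<phi> = Some v" using w by simp
    then have "v \<in> ?B (Suc n)" using w i by (auto intro!: exI[of _ "i # w"])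
    then show "\<exists>v\<in>H (Suc n). a Cre i u = Some v"
      using v unfolding chaos_def by (auto intro: span_base)
  qed
  then have "?S \<subseteq> H (Suc n)" by (fastforce simp: maps_into_def)
  then show "span ?S \<subseteq> H (Suc n)" by (rule span_minimal[OF _ subspace_chaos])
qed

text \<open>Putting one arbitrary letter in front of a creation word gives a nonempty word, whose
  product is defined at the vacuum by hypothesis. Linearity of \<open>a \<epsilon> i\<close> extends
  this to the span.\<close>

lemma chaos_subset_dom:
  assumes i: "i \<in> {1..d}"
  shows "H n \<subseteq> dom (a \<epsilon> i)"
  unfolding chaos_def
proof (rule span_minimal[OF _ linear_op_subspace_dom[OF linear_a[OF i]]], safe)
  fix u w assume w: "set w \<subseteq> {1..d}" "op_prod (map (a Cre) w) \<phi> = Some u"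
  have m: "map ((\<lambda>(\<epsilon>, i). a \<epsilon> i) \<circ> Pair Cre) w = map (a Cre) w" by auto
  have "\<phi> \<in> dom (op_prod (map (\<lambda>(\<epsilon>, i). a \<epsilon> i) ((\<epsilon>, i) # map (Pair Cre) w)))"
    using w i by (intro word_dom) auto
  then show "\<exists>y. a \<epsilon> i u = Some y" using w by (auto simp: m map_comp_Some_iff)
qed

lemma Cre_chaos: "i \<in> {1..d} \<Longrightarrow> maps_into (a Cre i) (H n) (H (Suc n))"
  using chaos_subset_dom[of i n Cre] unfolding chaos_Suc
  by (intro maps_intoI) (blast intro: span_base)

lemma Pres_chaos: "i \<in> {1..d} \<Longrightarrow> maps_into (a Pres i) (H n) (H n)"
  using chaos_subset_dom apc by (intro maps_into_if_op_image) (auto simp: joint_apc_def)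

lemma Ann_chaos: "i \<in> {1..d} \<Longrightarrow> maps_into (a Ann i) (H n) (pred_space H n)"
  using chaos_subset_dom apc by (intro maps_into_if_op_image) (auto simp: joint_apc_def)

text \<open>Creation is \<open>X i\<close> minus preservation and annihilation, so a filtration
  raised by one step under each \<open>X i\<close> absorbs it. Annihilation lands two levels below
  the target, hence the strong induction. The constant filtrations \<open>D\<close> and
  \<open>D'\<close> and the filtration \<open>F\<close> are the instances used later.\<close>

lemma chaos_subset_filtration:
  assumes sub: "\<And>n. subspace (W n)" and mono: "\<And>n. W n \<subseteq> W (Suc n)"
    and vac: "\<phi> \<in> W 0" and D: "\<And>n. W n \<subseteq> D"
    and X: "\<And>i n. i \<in> {1..d} \<Longrightarrow> maps_into (X i) (W n) (W (Suc n))"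
  shows "H n \<subseteq> W n"
proof (induction n rule: less_induct)
  case (less n)
  show ?case
  proof (cases n)
    case 0
    moreover have "span {\<phi>} \<subseteq> W 0" using vac sub by (intro span_minimal) auto
    ultimately show ?thesis by (simp add: chaos_0)
  next
    case (Suc m)
    have le: "W k \<subseteq> W l" if "k \<le> l" for k l
      using that mono by (rule lift_Suc_mono_le[rotated])
    \<comment> \<open>For \<open>m = 0\<close> this space is zero; otherwise it is
      \<open>H (m - 1)\<close>, covered by the induction hypothesis.\<close>
    have pred: "pred_space H m \<subseteq> W n"
      using less.IH[of "m - 1"] le[of "m - 1" n] subspace_0[OF sub] Suc
      by (cases m) (auto simp: pred_space_def)
    have Hm: "H m \<subseteq> W m" using less.IH Suc by blast
    have "v \<in> W n" if i: "i \<in> {1..d}" and u: "u \<in> H m" and v: "a Cre i u = Some v" for i u v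
    proof -
      have "u \<in> D" using u Hm D by blast
      then obtain x y where xy: "a Ann i u = Some x" "a Pres i u = Some y"
        "X i u = Some (x + y + v)" using X_split[OF i] v by (metis option.inject)
      have "x \<in> W n" using Ann_chaos[OF i, of m] u xy pred by (force elim: maps_intoE)
      moreover have "y \<in> W n"
        using Pres_chaos[OF i, of m] u xy Hm mono Suc by (force elim: maps_intoE)
      moreover have "x + y + v \<in> W n" using X[OF i, of m] u Hm xy Suc by (force elim: maps_intoE)
      ultimately have "x + y + v - (x + y) \<in> W n"
        by (meson subspace_diff subspace_add sub)
      then show ?thesis by simp
    qed
    then show ?thesis unfolding Suc chaos_Suc using sub Suc by (intro span_minimal) auto
  qed
qed

lemma chaos_subset_D: "H n \<subseteq> D"
  using chaos_subset_filtration[of "\<lambda>_. D"] subspace_D vac_mem_D X_maps_D by simp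

text \<open>The adjoint relation moves the outermost creation operator of \<open>v\<close> onto
  \<open>u\<close> as an annihilation operator, lowering both levels by one.\<close>

lemma chaos_orthogonal_Suc:
  assumes u: "u \<in> H m" and v: "v \<in> H (Suc n)"
    and pred: "\<And>x y. x \<in> pred_space H m \<Longrightarrow> y \<in> H n \<Longrightarrow> inner x y = 0"
  shows "inner u v = 0"
proof -
  have "orthogonal u v"
    using v unfolding chaos_Suc
  proof (rule orthogonal_to_span)
    fix z assume "z \<in> {v. \<exists>i\<in>{1..d}. \<exists>u\<in>H n. a Cre i u = Some v}"
    then obtain i y where i: "i \<in> {1..d}" and y: "y \<in> H n" "a Cre i y = Some z" by auto
    obtain x where x: "x \<in> pred_space H m" "a Ann i u = Some x"
      using Ann_chaos[OF i] u by (auto elim: maps_intoE)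
    have "inner z u = inner y x"
      using adjoint[OF i _ _ y(2) x(2)] y(1) u chaos_subset_D by blast
    then show "orthogonal u z" using pred[OF x(1) y(1)] by (simp add: orthogonal_def inner_commute)
  qed
  then show ?thesis by (simp add: orthogonal_def)
qed

text \<open>Lowering both levels repeatedly brings the smaller one to 0, where annihilation gives
  the zero vector.\<close>

lemma chaos_orthogonal:
  assumes "m < n" "u \<in> H m" "v \<in> H n"
  shows "inner u v = 0"
  using assms
proof (induction m arbitrary: n u v)
  case 0
  then show ?case using chaos_orthogonal_Suc[of u 0 v "n - 1"] by (auto simp: pred_space_def)
next
  case (Suc m)
  then obtain k where k: "n = Suc k" "m < k" by (cases n) auto
  then show ?case
    using chaos_orthogonal_Suc[of u "Suc m" v k] Suc by (auto simp: pred_space_def)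
qed

text \<open>The summands are pairwise orthogonal, so pairing the vanishing sum with each of them
  leaves its squared norm.\<close>

lemma three_term_zero:
  assumes "p \<in> pred_space H n" "q \<in> H n" "r \<in> H (Suc n)" "p + q + r = 0"
  shows "p = 0" "q = 0" "r = 0"
proof -
  have pq: "inner p q = 0" and pr: "inner p r = 0"
    using assms(1-3) chaos_orthogonal[of "n - 1" n p q] chaos_orthogonal[of "n - 1" "Suc n" p r]
    by (cases n; auto simp: pred_space_def)+
  have qr: "inner q r = 0" using assms(2,3) chaos_orthogonal by blast
  have "inner p (p + q + r) = 0" "inner q (p + q + r) = 0" "inner r (p + q + r) = 0"
    using assms(4) by auto
  then show "p = 0" "q = 0" "r = 0"
    using pq pr qr by (auto simp: inner_add_right inner_commute)
qed

section \<open>Identification with the graded polynomial spaces\<close>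

text \<open>The generated algebra has the identity of the whole space as unit, which need not belong
  to \<open>A\<close>. The orbits are therefore compared as sets of vectors, through invariance of
  \<open>D\<close> under each \<open>X i\<close>.\<close>

lemma X_dom_orbit: "\<forall>g\<in>generated_algebra (X ` {1..d}). \<phi> \<in> dom g" and D'_subset_D: "D' \<subseteq> D"
  using orbit_generated_subset[OF subspace_D vac_mem_D, of "X ` {1..d}"] X_maps_D by blast+

lemmas subspace_D' = orbit_generated_invariant(1)[OF X_dom_orbit]

lemma X_maps_D': "i \<in> {1..d} \<Longrightarrow> maps_into (X i) D' D'"
  using orbit_generated_invariant(2)[OF X_dom_orbit] by blast

lemma chaos_subset_D': "H n \<subseteq> D'"
  using chaos_subset_filtration[of "\<lambda>_. D'"] subspace_D' X_maps_D' D'_subset_D mem_orbit_generated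
  by blast

lemma a_maps_chaos_span:
  assumes i: "i \<in> {1..d}" and "u \<in> H n"
  shows "\<exists>v\<in>span (\<Union>n. H n). a \<epsilon> i u = Some v"
proof (cases \<epsilon>)
  case Ann
  have "pred_space H n \<subseteq> span (\<Union>n. H n)"
    by (cases n) (auto simp: pred_space_def span_zero intro: span_base)
  then show ?thesis using Ann Ann_chaos[OF i, of n] assms(2) unfolding maps_into_def by blast
next
  case Pres
  then show ?thesis using Pres_chaos[OF i, of n] assms(2)
    by (fastforce simp: maps_into_def intro: span_base)
next
  case Cre
  then show ?thesis using Cre_chaos[OF i, of n] assms(2)
    by (fastforce simp: maps_into_def intro: span_base)
qed

lemma a_maps_span: "i \<in> {1..d} \<Longrightarrow> maps_into (a \<epsilon> i) (span (\<Union>n. H n)) (span (\<Union>n. H n))"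
  using a_maps_chaos_span by (intro maps_into_span linear_a maps_intoI) auto

lemma chaos_span_subset_D': "span (\<Union>n. H n) \<subseteq> D'"
  using chaos_subset_D' subspace_D' by (intro span_minimal) auto

text \<open>The sum of the chaos spaces contains the vacuum and is invariant under all
  \<open>a \<epsilon> i\<close>, hence under each \<open>X i\<close>, so it absorbs the whole
  orbit.\<close>

lemma D'_eq: "D' = span (\<Union>n. H n)"
proof
  have "maps_into (X i) (span (\<Union>n. H n)) (span (\<Union>n. H n))" if i: "i \<in> {1..d}" for i
  proof (rule maps_intoI)
    fix u assume u: "u \<in> span (\<Union>n. H n)"
    then have "u \<in> D" using chaos_span_subset_D' D'_subset_D by blast
    then obtain x y z where xyz: "a Ann i u = Some x" "a Pres i u = Some y" "a Cre i u = Some z"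
      "X i u = Some (x + y + z)" using X_split[OF i] by blast
    then have "x \<in> span (\<Union>n. H n)" "y \<in> span (\<Union>n. H n)" "z \<in> span (\<Union>n. H n)"
      using maps_intoD[OF a_maps_span[OF i] u] by blast+
    then show "\<exists>v\<in>span (\<Union>n. H n). X i u = Some v" using xyz by (auto intro: span_add)
  qed
  moreover have "\<phi> \<in> span (\<Union>n. H n)"
    by (auto intro!: span_base exI[of _ 0] simp: chaos_0)
  ultimately show "D' \<subseteq> span (\<Union>n. H n)"
    by (intro orbit_generated_subset(1)) auto
qed (rule chaos_span_subset_D')

lemma a_maps_D': "i \<in> {1..d} \<Longrightarrow> maps_into (a \<epsilon> i) D' D'"
  using a_maps_span D'_eq by simp

section \<open>The polynomial filtration and its graded pieces\<close>

lemma X_word_mem_filtration: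
  assumes "\<phi> \<in> W 0" "\<And>i n. i \<in> {1..d} \<Longrightarrow> maps_into (X i) (W n) (W (Suc n))" "set w \<subseteq> {1..d}"
  shows "\<exists>v\<in>W (length w). op_prod (map X w) \<phi> = Some v"
  using assms(3)
proof (induction w)
  case Nil
  then show ?case using assms(1) by simp
next
  case (Cons i w)
  then obtain u where "u \<in> W (length w)" "op_prod (map X w) \<phi> = Some u" by auto
  then show ?case using assms(2)[of i "length w"] Cons.prems by (auto simp: maps_into_def)
qed

lemma X_maps_poly:
  assumes i: "i \<in> {1..d}"
  shows "maps_into (X i) (F n) (F (Suc n))"
  unfolding poly_space_eq_span[of _ _ _ n]
proof (rule maps_into_span[OF linear_X[OF i]], simp add: poly_space_eq_span, rule maps_intoI, safe)
  fix w assume w: "set w \<subseteq> {1..d}" "length w \<le> n"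
  \<comment> \<open>Both words have a genuine value at the vacuum because \<open>D\<close> is
    invariant under each \<open>X i\<close>; thus \<open>the\<close> returns that value.\<close>
  obtain u v where uv: "op_prod (map X w) \<phi> = Some u" "op_prod (map X (i # w)) \<phi> = Some v"
    using X_word_mem_filtration[of "\<lambda>_. D"] vac_mem_D X_maps_D w i
    by (metis insert_subset list.simps(15))
  have "v \<in> F (Suc n)"
    unfolding poly_space_eq_span using w i uv
    by (intro span_base image_eqI[of _ _ "i # w"]) auto
  then show "\<exists>v\<in>F (Suc n). X i (the (op_prod (map X w) \<phi>)) = Some v"
    using uv by auto
qed

lemma poly_subset_D: "F n \<subseteq> D"
  unfolding poly_space_eq_span
  using X_word_mem_filtration[of "\<lambda>_. D"] vac_mem_D X_maps_D subspace_D
  by (intro span_minimal) fastforce+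

lemma poly_mono: "m \<le> n \<Longrightarrow> F m \<subseteq> F n"
  unfolding poly_space_eq_span by (intro span_mono image_mono) auto

lemma vac_mem_poly: "\<phi> \<in> F n"
  unfolding poly_space_eq_span by (auto intro!: span_base image_eqI[of _ _ "[]"])

lemma subspace_poly: "subspace (F n)"
  by (simp add: poly_space_eq_span)

lemma chaos_subset_poly: "H n \<subseteq> F n"
  by (intro chaos_subset_filtration subspace_poly poly_mono vac_mem_poly poly_subset_D X_maps_poly)
    auto

text \<open>Each \<open>X i\<close> moves a chaos space by at most one level, so words of length at
  most \<open>n\<close> stay in the sum of levels up to \<open>n\<close>. The converse is
  \<open>chaos_subset_poly\<close>.\<close>

lemma poly_eq_chaos_sum: "F n = span (\<Union>k\<le>n. H k)"
proof
  let ?V = "\<lambda>n. span (\<Union>k\<le>n. H k)"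
  have H: "H k \<subseteq> ?V n" if "k \<le> n" for k n
    using that by (intro subsetI span_base) blast
  show "?V n \<subseteq> F n"
    using chaos_subset_poly poly_mono subspace_poly by (intro span_minimal UN_least) (auto, blast)
  have X: "maps_into (X i) (?V n) (?V (Suc n))" if i: "i \<in> {1..d}" for i n
  proof (rule maps_into_span[OF linear_X[OF i] subspace_span], rule maps_intoI)
    fix u assume "u \<in> (\<Union>k\<le>n. H k)"
    then obtain k where k: "k \<le> n" "u \<in> H k" by auto
    then obtain x y z where xyz: "a Ann i u = Some x" "a Pres i u = Some y" "a Cre i u = Some z"
      "X i u = Some (x + y + z)" using X_split[OF i] chaos_subset_D by blast
    have "pred_space H k \<subseteq> ?V (Suc n)"
      using k H[of "k - 1" "Suc n"] by (cases k) (auto simp: pred_space_def span_zero)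
    then have "x \<in> ?V (Suc n)" using Ann_chaos[OF i, of k] k xyz by (blast dest: maps_intoD)
    moreover have "y \<in> H k" "z \<in> H (Suc k)"
      using maps_intoD[OF Pres_chaos[OF i] k(2)] maps_intoD[OF Cre_chaos[OF i] k(2)] xyz by auto
    then have "y \<in> ?V (Suc n)" "z \<in> ?V (Suc n)"
      using H[of k "Suc n"] H[of "Suc k" "Suc n"] k(1) by auto
    ultimately show "\<exists>v\<in>?V (Suc n). X i u = Some v" using xyz by (auto intro: span_add)
  qed
  have "the (op_prod (map X w) \<phi>) \<in> ?V n" if w: "set w \<subseteq> {1..d}" "length w \<le> n" for w
  proof -
    have "\<phi> \<in> ?V 0" by (auto intro!: span_base simp: chaos_0)
    then obtain v where "v \<in> ?V (length w)" "op_prod (map X w) \<phi> = Some v"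
      using X_word_mem_filtration[of ?V] X w(1) by blast
    moreover have "?V (length w) \<subseteq> ?V n" using w(2) by (intro span_mono UN_mono) auto
    ultimately show ?thesis by auto
  qed
  then show "F n \<subseteq> ?V n"
    unfolding poly_space_eq_span by (intro span_minimal) auto
qed

text \<open>\<open>F (Suc m)\<close> is the sum of \<open>F m\<close> and \<open>H (Suc m)\<close>,
  and these are orthogonal, so the chaos space is exactly the orthogonal complement defining
  \<open>G\<close>.\<close>

lemma graded_eq_chaos: "G n = H n"
proof (cases n)
  case 0
  then show ?thesis by (simp add: poly_eq_chaos_sum span_eq_iff[THEN iffD2, OF subspace_chaos])
next
  case (Suc m)
  have orth: "inner u h = 0" if "u \<in> F m" "h \<in> H n" for u h
  proof -
    have "orthogonal h u"
      using that(1) unfolding poly_eq_chaos_sum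
    proof (rule orthogonal_to_span)
      fix y assume "y \<in> (\<Union>k\<le>m. H k)"
      then obtain k where "y \<in> H k" "k < n" using Suc by auto
      then have "inner y h = 0" using that(2) chaos_orthogonal by blast
      then show "orthogonal h y" by (simp add: orthogonal_def inner_commute)
    qed
    then show ?thesis by (simp add: orthogonal_def inner_commute)
  qed
  have "v \<in> H n" if v: "v \<in> F (Suc m)" "\<forall>u\<in>F m. orthogonal u v" for v
  proof -
    have "(\<Union>k\<le>Suc m. H k) = (\<Union>k\<le>m. H k) \<union> H n" using Suc by (auto simp: le_Suc_eq)
    then obtain x h where xh: "v = x + h" "x \<in> F m" "h \<in> H n"
      using v(1) by (auto simp: poly_eq_chaos_sum span_Un span_eq_iff[THEN iffD2, OF subspace_chaos])
    \<comment> \<open>Both \<open>v\<close> and \<open>h\<close> are orthogonal to the component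
      \<open>x\<close> in \<open>F m\<close>, so \<open>x\<close> is orthogonal to itself.\<close>
    have "inner x v = 0" using v(2) xh(2) by (simp add: orthogonal_def)
    then have "inner x x = 0" using orth[OF xh(2,3)] xh(1) by (simp add: inner_add_right)
    then show ?thesis using xh by simp
  qed
  moreover have "v \<in> F (Suc m) \<and> (\<forall>u\<in>F m. orthogonal u v)" if "v \<in> H n" for v
    using that orth chaos_subset_poly[of n] Suc unfolding orthogonal_def by blast
  ultimately show ?thesis unfolding Suc graded_space.simps by blast
qed

section \<open>Existence and uniqueness of the minimal decomposition\<close>

lemma is_minimal_apc_restrict:
  assumes i: "i \<in> {1..d}"
  shows "is_minimal_apc d X \<phi> i (\<lambda>\<epsilon>. a \<epsilon> i |` D')"
proof -
  have dom: "D' \<subseteq> dom (a \<epsilon> i)" for \<epsilon>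
    using a_maps_D'[OF i, of \<epsilon>] by (auto simp: maps_into_def)
  have lin: "linear_op (a \<epsilon> i |` D') \<and> dom (a \<epsilon> i |` D') = D'" for \<epsilon>
    using linear_op_restrict[OF linear_a[OF i] subspace_D' dom] dom by auto
  have sum: "X i u = apc_sum (\<lambda>\<epsilon>. a \<epsilon> i |` D') u" if u: "u \<in> D'" for u
  proof -
    have "u \<in> D" using u D'_subset_D by blast
    then show ?thesis by (rule X_split[OF i]) (use u in \<open>simp add: apc_sum_def op_add_def\<close>)
  qed
  have image: "op_image (a \<epsilon> i |` D') S \<subseteq> W" if "maps_into (a \<epsilon> i) S W" for S W \<epsilon>
    using that by (auto simp: op_image_def restrict_map_def split: if_splits dest: maps_intoD)
  show ?thesis
    \<comment> \<open>The equation between functions is needed because \<open>pred_space\<close>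
      takes the whole family \<open>G\<close> as argument.\<close>
    unfolding is_minimal_apc_def graded_eq_chaos[abs_def]
    using lin sum image[OF Ann_chaos[OF i]] image[OF Pres_chaos[OF i]] image[OF Cre_chaos[OF i]]
    by (intro conjI allI ballI) simp_all
qed

text \<open>On \<open>H n\<close> the two splittings of \<open>X i\<close> differ by vectors of
  three neighbouring levels with sum zero, so they agree; linearity carries this to
  \<open>D'\<close>.\<close>

lemma is_minimal_apc_unique:
  assumes i: "i \<in> {1..d}" and b: "is_minimal_apc d X \<phi> i b"
  shows "b = (\<lambda>\<epsilon>. a \<epsilon> i |` D')"
proof
  fix \<epsilon>
  have lin: "linear_op (b \<epsilon>)" and dom: "dom (b \<epsilon>) = D'" for \<epsilon>
    using b by (auto simp: is_minimal_apc_def)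
  have eq: "\<exists>v. b \<epsilon> u = Some v \<and> a \<epsilon> i u = Some v" if u: "u \<in> H n" for u n
  proof -
    have uD: "u \<in> D'" "u \<in> D" using u chaos_subset_D' chaos_subset_D by blast+
    obtain x y z where xyz: "a Ann i u = Some x" "a Pres i u = Some y" "a Cre i u = Some z"
      "X i u = Some (x + y + z)" using X_split[OF i uD(2)] by blast
    have "apc_sum b u = Some (x + y + z)"
      using b uD(1) xyz(4) by (auto simp: is_minimal_apc_def)
    then obtain x' y' z' where xyz': "b Ann u = Some x'" "b Pres u = Some y'" "b Cre u = Some z'"
      and sum: "x + y + z = x' + y' + z'" by (auto simp: apc_sum_eq_Some)
    have "x \<in> pred_space H n" "y \<in> H n" "z \<in> H (Suc n)"
      using Ann_chaos[OF i, of n] Pres_chaos[OF i, of n] Cre_chaos[OF i, of n] u xyz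
      by (auto simp: maps_into_def)
    moreover have "x' \<in> pred_space H n" "y' \<in> H n" "z' \<in> H (Suc n)"
      using b u xyz' unfolding is_minimal_apc_def graded_eq_chaos[abs_def] op_image_def by blast+
    ultimately have "x - x' \<in> pred_space H n" "y - y' \<in> H n" "z - z' \<in> H (Suc n)"
      using subspace_diff subspace_chaos subspace_pred_chaos by blast+
    moreover have "(x - x') + (y - y') + (z - z') = 0" using sum by (simp add: algebra_simps)
    ultimately have "x - x' = 0" "y - y' = 0" "z - z' = 0" by (rule three_term_zero)+
    then show ?thesis using xyz xyz' by (cases \<epsilon>) auto
  qed
  have "b \<epsilon> u = a \<epsilon> i u" if "u \<in> D'" for u
    using lin linear_a[OF i] _ that[unfolded D'_eq]
    by (rule linear_op_eq_on_span) (use eq in blast)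
  \<comment> \<open>Equality of partial maps also requires both to be undefined off
    \<open>D'\<close>.\<close>
  moreover have "b \<epsilon> u = None" if "u \<notin> D'" for u using dom that by blast
  ultimately show "b \<epsilon> = a \<epsilon> i |` D'"
    unfolding restrict_map_def fun_eq_iff by presburger
qed

lemma minimal_apc_eq: "i \<in> {1..d} \<Longrightarrow> minimal_apc d X \<phi> \<epsilon> i = a \<epsilon> i |` D'"
  unfolding minimal_apc_def
  using the_equality[of "is_minimal_apc d X \<phi> i", OF is_minimal_apc_restrict is_minimal_apc_unique]
  by simp

section \<open>The algebra generated by the APC operators\<close>

lemma a_dom_orbit: "\<forall>g\<in>generated_algebra {a \<epsilon> i | \<epsilon> i. i \<in> {1..d}}. \<phi> \<in> dom g"
  and D''_subset_D': "D'' \<subseteq> D'"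
  using orbit_generated_subset[OF subspace_D' mem_orbit_generated, of "{a \<epsilon> i | \<epsilon> i. i \<in> {1..d}}"]
    a_maps_D' by blast+

text \<open>Off \<open>D\<close> the operator \<open>X i\<close> may differ from the sum of its
  three parts, so the algebras are not compared. Instead, at each vector of \<open>D''\<close> the
  value of \<open>X i\<close> is a sum of three vectors of \<open>D''\<close>.\<close>

lemma D''_eq_D': "D'' = D'"
proof
  have a: "maps_into (a \<epsilon> i) D'' D''" if "i \<in> {1..d}" for \<epsilon> i
    using orbit_generated_invariant(2)[OF a_dom_orbit] that by blast
  have sub: "subspace D''" by (rule orbit_generated_invariant(1)[OF a_dom_orbit])
  have "maps_into (X i) D'' D''" if i: "i \<in> {1..d}" for i
  proof (rule maps_intoI)
    fix u assume u: "u \<in> D''"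
    then have "u \<in> D" using D''_subset_D' D'_subset_D by blast
    then obtain x y z where xyz: "a Ann i u = Some x" "a Pres i u = Some y" "a Cre i u = Some z"
      "X i u = Some (x + y + z)" using X_split[OF i] by blast
    then have "x \<in> D''" "y \<in> D''" "z \<in> D''" using maps_intoD[OF a[OF i] u] by blast+
    then show "\<exists>v\<in>D''. X i u = Some v" using xyz(4) subspace_add[OF sub] by blast
  qed
  then show "D' \<subseteq> D''"
    using sub mem_orbit_generated by (intro orbit_generated_subset(1)) auto
qed (rule D''_subset_D')

lemma joint_apc_generated: "joint_apc d X a \<phi> (generated_algebra {a \<epsilon> i | \<epsilon> i. i \<in> {1..d}})"
proof -
  have "D'' \<subseteq> D" using D''_subset_D' D'_subset_D by blast
  with apc show ?thesis by (rule joint_apc_antimono)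
qed

end

theorem lemma2p5:
  fixes A :: "'h::{real_inner, complete_space} partial_op set"
    and \<phi> :: 'h
    and d :: nat
    and X :: "nat \<Rightarrow> 'h partial_op"
    and a :: "apc \<Rightarrow> nat \<Rightarrow> 'h partial_op"
  assumes "nc_prob_space A \<phi>"
    and "\<And>i. i \<in> {1..d} \<Longrightarrow> X i \<in> A"
    and "\<And>i. i \<in> {1..d} \<Longrightarrow> symmetric_op (X i)"
    and "joint_apc d X a \<phi> A"
    and "A' = generated_algebra (X ` {1..d})"
    and "A'' = generated_algebra {a \<epsilon> i | \<epsilon> i. i \<in> {1..d}}"
  shows "(\<forall>i\<in>{1..d}. \<forall>\<epsilon>. a \<epsilon> i |` orbit A' \<phi> = minimal_apc d X \<phi> \<epsilon> i |` orbit A' \<phi>) \<and>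
    (\<forall>g\<in>A''. \<phi> \<in> dom g) \<and> orbit A'' \<phi> = orbit A' \<phi> \<and> joint_apc d X a \<phi> A''"
proof -
  interpret joint_apc_decomposition d X a \<phi> A
    using assms(1,2,4) by unfold_locales
  show ?thesis
    \<comment> \<open>By \<open>minimal_apc_eq\<close> the minimal operators are already
      restrictions to this orbit, so restricting them again changes nothing.\<close>
    unfolding assms(5,6) using minimal_apc_eq a_dom_orbit D''_eq_D' joint_apc_generated by auto
qed

end
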